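(* Let $R$ be a unital (not necessarily commutative) ring, let $M$ be a non-zero left $R$-module, and let $E=\mathrm{End}_R(M)$. Let $C\subseteq E$ be a commutative exceptional clique. Then $\mathrm{Mat}_2(E)$ has an exceptional clique of size $2\cdot\#C$. Consequently $\omega(\mathrm{Mat}_2(E))\ge 2\,\omega_{\mathrm{com}}(E)$.
   Context: An exceptional clique in a unital ring $S$ is a subset $C\subseteq S$ such that $u-v$ is a unit of $S$ for all distinct $u,v\in C$; it is commutative if its elements commute pairwise. $\omega(S)$ denotes the supremum of the cardinalities of the exceptional cliques in $S$, and $\omega_{\mathrm{com}}(S)$ denotes the same supremum restricted to commutative exceptional cliques. *)

theory Defs
  imports
    "HOL-Algebra.Module"
    "HOL-Library.FuncSet"
    "Jordan_Normal_Form.Matrix"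
begin

text \<open>
  The locale \<open>module\<close> of HOL-Algebra requires a commutative ring of scalars; the following
  repeats its axioms over an arbitrary unital ring.
\<close>

locale left_module = R?: ring R + M?: abelian_group M
  for R :: "('r, 'c) ring_scheme" (structure) and M :: "('r, 'a, 'd) module_scheme" (structure) +
  assumes smult_closed:
      "\<lbrakk>a \<in> carrier R; x \<in> carrier M\<rbrakk> \<Longrightarrow> a \<odot>\<^bsub>M\<^esub> x \<in> carrier M"
    and smult_l_distr:
      "\<lbrakk>a \<in> carrier R; b \<in> carrier R; x \<in> carrier M\<rbrakk> \<Longrightarrow>
        (a \<oplus>\<^bsub>R\<^esub> b) \<odot>\<^bsub>M\<^esub> x = a \<odot>\<^bsub>M\<^esub> x \<oplus>\<^bsub>M\<^esub> b \<odot>\<^bsub>M\<^esub> x"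
    and smult_r_distr:
      "\<lbrakk>a \<in> carrier R; x \<in> carrier M; y \<in> carrier M\<rbrakk> \<Longrightarrow>
        a \<odot>\<^bsub>M\<^esub> (x \<oplus>\<^bsub>M\<^esub> y) = a \<odot>\<^bsub>M\<^esub> x \<oplus>\<^bsub>M\<^esub> a \<odot>\<^bsub>M\<^esub> y"
    and smult_assoc1:
      "\<lbrakk>a \<in> carrier R; b \<in> carrier R; x \<in> carrier M\<rbrakk> \<Longrightarrow>
        (a \<otimes>\<^bsub>R\<^esub> b) \<odot>\<^bsub>M\<^esub> x = a \<odot>\<^bsub>M\<^esub> (b \<odot>\<^bsub>M\<^esub> x)"
    and smult_one:
      "x \<in> carrier M \<Longrightarrow> \<one>\<^bsub>R\<^esub> \<odot>\<^bsub>M\<^esub> x = x"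

text \<open>
  Endomorphisms are taken to be extensional (\<open>undefined\<close> off \<open>carrier M\<close>), so that each
  endomorphism of \<open>M\<close> is represented by exactly one HOL function.
\<close>

definition End_ring ::
    "('r, 'c) ring_scheme \<Rightarrow> ('r, 'a, 'd) module_scheme \<Rightarrow> ('a \<Rightarrow> 'a) ring" where
  "End_ring R M = \<lparr>
     carrier = {f \<in> carrier M \<rightarrow>\<^sub>E carrier M.
        (\<forall>x \<in> carrier M. \<forall>y \<in> carrier M. f (x \<oplus>\<^bsub>M\<^esub> y) = f x \<oplus>\<^bsub>M\<^esub> f y) \<and>
        (\<forall>a \<in> carrier R. \<forall>x \<in> carrier M. f (a \<odot>\<^bsub>M\<^esub> x) = a \<odot>\<^bsub>M\<^esub> f x)},
     monoid.mult = (\<lambda>f g. compose (carrier M) f g),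
     one = (\<lambda>x \<in> carrier M. x),
     zero = (\<lambda>x \<in> carrier M. \<zero>\<^bsub>M\<^esub>),
     add = (\<lambda>f g. \<lambda>x \<in> carrier M. f x \<oplus>\<^bsub>M\<^esub> g x)\<rparr>"

text \<open>
  The library's \<open>ring_mat\<close> takes its entries in a type of class \<open>semiring_1\<close>; here they lie in
  the carrier of a ring record.
\<close>

definition mat_ring :: "nat \<Rightarrow> ('e, 'c) ring_scheme \<Rightarrow> 'e mat ring" where
  "mat_ring n S = \<lparr>
     carrier = {A \<in> carrier_mat n n. \<forall>i < n. \<forall>j < n. A $$ (i, j) \<in> carrier S},
     monoid.mult = (\<lambda>A B. mat n n (\<lambda>(i, j). \<Oplus>\<^bsub>S\<^esub>k\<in>{..<n}. A $$ (i, k) \<otimes>\<^bsub>S\<^esub> B $$ (k, j))),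
     one = mat n n (\<lambda>(i, j). if i = j then \<one>\<^bsub>S\<^esub> else \<zero>\<^bsub>S\<^esub>),
     zero = mat n n (\<lambda>(i, j). \<zero>\<^bsub>S\<^esub>),
     add = (\<lambda>A B. mat n n (\<lambda>(i, j). A $$ (i, j) \<oplus>\<^bsub>S\<^esub> B $$ (i, j)))\<rparr>"

definition exceptional_clique :: "('s, 'c) ring_scheme \<Rightarrow> 's set \<Rightarrow> bool" where
  "exceptional_clique S C \<longleftrightarrow>
     C \<subseteq> carrier S \<and> (\<forall>u \<in> C. \<forall>v \<in> C. u \<noteq> v \<longrightarrow> u \<ominus>\<^bsub>S\<^esub> v \<in> Units S)"

definition comm_exceptional_clique :: "('s, 'c) ring_scheme \<Rightarrow> 's set \<Rightarrow> bool" where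
  "comm_exceptional_clique S C \<longleftrightarrow>
     exceptional_clique S C \<and> (\<forall>u \<in> C. \<forall>v \<in> C. u \<otimes>\<^bsub>S\<^esub> v = v \<otimes>\<^bsub>S\<^esub> u)"

unbundle cardinal_syntax

text \<open>
  Cardinals are the cardinal orders of the library, compared by \<open>\<le>o\<close>. The supremum of the
  cardinalities of a family of sets is unique only up to \<open>=o\<close>, whence the choice operator.
  The definition compares with upper bounds on the same type only; by \<open>card_Sup_least\<close> this is
  no restriction.
\<close>

definition is_card_Sup :: "'a set set \<Rightarrow> 'a rel \<Rightarrow> bool" where
  "is_card_Sup \<C> r \<longleftrightarrow>
     Card_order r \<and> (\<forall>C \<in> \<C>. |C| \<le>o r) \<and>
     (\<forall>r' :: 'a rel. Card_order r' \<and> (\<forall>C \<in> \<C>. |C| \<le>o r') \<longrightarrow> r \<le>o r')"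

definition card_Sup :: "'a set set \<Rightarrow> 'a rel" where
  "card_Sup \<C> = (SOME r. is_card_Sup \<C> r)"

lemma is_card_Sup_card_Sup: "is_card_Sup \<C> (card_Sup \<C>)"
proof -
  let ?U = "{r :: 'a rel. Card_order r \<and> (\<forall>C \<in> \<C>. |C| \<le>o r)}"
  have "|UNIV :: 'a set| \<in> ?U"
    by (intro CollectI conjI ballI card_of_Card_order card_of_mono1 subset_UNIV)
  then have "?U \<noteq> {}" by (metis empty_iff)
  moreover have "\<forall>r \<in> ?U. Well_order r"
  proof
    fix r assume "r \<in> ?U"
    then have "Card_order r" by (elim CollectE conjE)
    then show "Well_order r" by (rule card_order_on_well_order_on)
  qed
  ultimately have "\<exists>r \<in> ?U. \<forall>r' \<in> ?U. r \<le>o r'"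
    by (rule exists_minim_Well_order)
  then obtain r where r: "r \<in> ?U" and least: "\<forall>r' \<in> ?U. r \<le>o r'" ..
  have "is_card_Sup \<C> r"
    unfolding is_card_Sup_def
  proof (intro conjI allI impI)
    show "Card_order r" using r by (elim CollectE conjE)
    show "\<forall>C \<in> \<C>. |C| \<le>o r" using r by (elim CollectE conjE)
    fix r' :: "'a rel" assume "Card_order r' \<and> (\<forall>C \<in> \<C>. |C| \<le>o r')"
    then have "r' \<in> ?U" by (rule CollectI)
    with least show "r \<le>o r'" ..
  qed
  then show ?thesis
    unfolding card_Sup_def by (rule someI)
qed

lemma Card_order_card_Sup: "Card_order (card_Sup \<C>)"
  using is_card_Sup_card_Sup[of \<C>] unfolding is_card_Sup_def by (elim conjE)

lemma card_Sup_upper: "C \<in> \<C> \<Longrightarrow> |C| \<le>o card_Sup \<C>"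
  using is_card_Sup_card_Sup[of \<C>] unfolding is_card_Sup_def by (elim conjE bspec)

lemma card_Sup_least:
  fixes r :: "'b rel"
  assumes r: "Card_order r" and ub: "\<And>C. C \<in> \<C> \<Longrightarrow> |C| \<le>o r"
  shows "card_Sup \<C> \<le>o r"
proof (rule disjE)
  show "card_Sup \<C> \<le>o r \<or> r \<le>o card_Sup \<C>"
    by (intro ordLeq_total card_order_on_well_order_on[OF r]
        card_order_on_well_order_on[OF Card_order_card_Sup])
next
  assume "r \<le>o card_Sup \<C>"
  then have "\<exists>p. Field p \<le> Field (card_Sup \<C>) \<and> r =o p \<and> p \<le>o card_Sup \<C>"
    by (rule internalize_ordLeq[THEN iffD1])
  then obtain p :: "'a rel" where p: "r =o p" by (elim exE conjE)
  have "Card_order p"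
    by (rule Card_order_ordIso2[OF r p])
  moreover have "\<forall>C \<in> \<C>. |C| \<le>o p"
    by (intro ballI ordLeq_ordIso_trans[OF ub p])
  ultimately have "card_Sup \<C> \<le>o p"
    using is_card_Sup_card_Sup[of \<C>] unfolding is_card_Sup_def by (elim conjE allE impE) (rule conjI)
  then show ?thesis
    by (rule ordLeq_ordIso_trans[OF _ ordIso_symmetric[OF p]])
qed

definition omega :: "('s, 'c) ring_scheme \<Rightarrow> 's rel" where
  "omega S = card_Sup {C. exceptional_clique S C}"

definition omega_com :: "('s, 'c) ring_scheme \<Rightarrow> 's rel" where
  "omega_com S = card_Sup {C. comm_exceptional_clique S C}"

end

theory Submission
  imports Defs
begin

text \<open>
  For a commutative exceptional clique \<open>C\<close> in a ring with \<open>1 \<noteq> 0\<close>, take, for \<open>a \<in> C\<close>, the matrices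
  \<open>X a = [[a, 0], [-a\<^sup>2, a]]\<close> and \<open>Y a = [[a, 1], [-a\<^sup>2 - 1, -a]]\<close>. The differences \<open>X a - X b\<close> and
  \<open>Y a - Y b\<close> are lower triangular with diagonal entries \<open>\<plusminus>(a - b)\<close>, and
  \<open>X a - Y b = [[a - b, -1], [b\<^sup>2 + 1 - a\<^sup>2, a + b]]\<close> has commuting entries and determinant \<open>1\<close>
  because \<open>a\<close> and \<open>b\<close> commute. The inequality of suprema follows at once if the supremum for \<open>C\<close>
  is attained; this is so if it is finite, and if it is infinite the factor 2 is absorbed.
\<close>

section \<open>The endomorphism ring of a module\<close>

context left_module
begin

lemma smult_zero:
  assumes "a \<in> carrier R"
  shows "a \<odot>\<^bsub>M\<^esub> \<zero>\<^bsub>M\<^esub> = \<zero>\<^bsub>M\<^esub>"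
  using smult_r_distr[OF assms, of "\<zero>\<^bsub>M\<^esub>" "\<zero>\<^bsub>M\<^esub>"] smult_closed[OF assms, of "\<zero>\<^bsub>M\<^esub>"] by simp

lemma smult_minus:
  assumes "a \<in> carrier R" "x \<in> carrier M"
  shows "a \<odot>\<^bsub>M\<^esub> (\<ominus>\<^bsub>M\<^esub> x) = \<ominus>\<^bsub>M\<^esub> (a \<odot>\<^bsub>M\<^esub> x)"
proof -
  have "a \<odot>\<^bsub>M\<^esub> (\<ominus>\<^bsub>M\<^esub> x) \<oplus>\<^bsub>M\<^esub> a \<odot>\<^bsub>M\<^esub> x = \<zero>\<^bsub>M\<^esub>"
    using assms smult_r_distr[of a "\<ominus>\<^bsub>M\<^esub> x" x] by (simp add: M.l_neg smult_zero)
  then show ?thesis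
    using assms by (intro M.minus_equality[symmetric]) (simp_all add: smult_closed)
qed

lemma End_ring_closed: "f \<in> carrier (End_ring R M) \<Longrightarrow> x \<in> carrier M \<Longrightarrow> f x \<in> carrier M"
  by (auto simp: End_ring_def)

lemma End_ring_add:
  "f \<in> carrier (End_ring R M) \<Longrightarrow> x \<in> carrier M \<Longrightarrow> y \<in> carrier M \<Longrightarrow>
    f (x \<oplus>\<^bsub>M\<^esub> y) = f x \<oplus>\<^bsub>M\<^esub> f y"
  by (simp add: End_ring_def)

lemma End_ring_smult:
  "f \<in> carrier (End_ring R M) \<Longrightarrow> a \<in> carrier R \<Longrightarrow> x \<in> carrier M \<Longrightarrow>
    f (a \<odot>\<^bsub>M\<^esub> x) = a \<odot>\<^bsub>M\<^esub> f x"
  by (simp add: End_ring_def)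

text \<open>Members of the carrier are all \<open>undefined\<close> outside
  \<open>carrier M\<close>, so the values on \<open>carrier M\<close> determine them. This reduces
  every ring law to a pointwise identity in \<open>M\<close>.\<close>

lemma End_ring_eqI:
  assumes "f \<in> carrier (End_ring R M)" "g \<in> carrier (End_ring R M)"
    and "\<And>x. x \<in> carrier M \<Longrightarrow> f x = g x"
  shows "f = g"
proof (rule extensionalityI)
  show "f \<in> extensional (carrier M)" "g \<in> extensional (carrier M)"
    using assms(1,2) by (simp_all add: End_ring_def PiE_def)
qed (rule assms(3))

lemma End_ringI:
  assumes "f \<in> extensional (carrier M)" "\<And>x. x \<in> carrier M \<Longrightarrow> f x \<in> carrier M"
    and "\<And>x y. x \<in> carrier M \<Longrightarrow> y \<in> carrier M \<Longrightarrow> f (x \<oplus>\<^bsub>M\<^esub> y) = f x \<oplus>\<^bsub>M\<^esub> f y"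
    and "\<And>a x. a \<in> carrier R \<Longrightarrow> x \<in> carrier M \<Longrightarrow> f (a \<odot>\<^bsub>M\<^esub> x) = a \<odot>\<^bsub>M\<^esub> f x"
  shows "f \<in> carrier (End_ring R M)"
  using assms by (simp add: End_ring_def PiE_def)

lemma End_ring_apply:
  assumes "x \<in> carrier M"
  shows "(f \<oplus>\<^bsub>End_ring R M\<^esub> g) x = f x \<oplus>\<^bsub>M\<^esub> g x"
    and "(f \<otimes>\<^bsub>End_ring R M\<^esub> g) x = f (g x)"
    and "\<zero>\<^bsub>End_ring R M\<^esub> x = \<zero>\<^bsub>M\<^esub>"
    and "\<one>\<^bsub>End_ring R M\<^esub> x = x"
  using assms by (simp_all add: End_ring_def compose_def)

lemma End_ring_extensional:
  "f \<oplus>\<^bsub>End_ring R M\<^esub> g \<in> extensional (carrier M)" "f \<otimes>\<^bsub>End_ring R M\<^esub> g \<in> extensional (carrier M)"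
  "\<zero>\<^bsub>End_ring R M\<^esub> \<in> extensional (carrier M)" "\<one>\<^bsub>End_ring R M\<^esub> \<in> extensional (carrier M)"
  by (simp_all add: End_ring_def)

lemma End_ring_op_closed:
  "f \<in> carrier (End_ring R M) \<Longrightarrow> g \<in> carrier (End_ring R M) \<Longrightarrow>
    f \<oplus>\<^bsub>End_ring R M\<^esub> g \<in> carrier (End_ring R M)"
  "f \<in> carrier (End_ring R M) \<Longrightarrow> g \<in> carrier (End_ring R M) \<Longrightarrow>
    f \<otimes>\<^bsub>End_ring R M\<^esub> g \<in> carrier (End_ring R M)"
  "\<zero>\<^bsub>End_ring R M\<^esub> \<in> carrier (End_ring R M)"
  "\<one>\<^bsub>End_ring R M\<^esub> \<in> carrier (End_ring R M)"
  by (rule End_ringI; simp add: End_ring_extensional End_ring_apply End_ring_closed End_ring_add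
      End_ring_smult smult_closed smult_zero smult_r_distr M.a_ac)+

lemma ring_End_ring: "ring (End_ring R M)"
proof (intro ringI abelian_groupI monoidI)
  fix f assume f: "f \<in> carrier (End_ring R M)"
  \<comment> \<open>The additive inverse is the one existential axiom. Pointwise negation is the
    witness; \<open>smult_minus\<close> makes it linear over \<open>R\<close>.\<close>
  let ?g = "\<lambda>x \<in> carrier M. \<ominus>\<^bsub>M\<^esub> f x"
  have g: "?g \<in> carrier (End_ring R M)"
    using f by (intro End_ringI) (simp_all add: End_ring_closed End_ring_add End_ring_smult
        smult_closed smult_minus M.minus_add)
  have "?g \<oplus>\<^bsub>End_ring R M\<^esub> f = \<zero>\<^bsub>End_ring R M\<^esub>"
    using f g by (intro End_ring_eqI)
      (simp_all add: End_ring_op_closed End_ring_apply End_ring_closed M.l_neg)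
  with g show "\<exists>g \<in> carrier (End_ring R M). g \<oplus>\<^bsub>End_ring R M\<^esub> f = \<zero>\<^bsub>End_ring R M\<^esub>"
    by blast
\<comment> \<open>The remaining axioms are closure conditions or equations checked pointwise.
  Distributivity of a left factor over a sum is its additivity, \<open>End_ring_add\<close>.\<close>
qed (rule End_ring_eqI; simp add: End_ring_op_closed End_ring_apply End_ring_closed End_ring_add M.a_ac
    | simp add: End_ring_op_closed)+

text \<open>This is where \<open>M\<close> being non-zero enters: it keeps the families
  \<open>X\<close> and \<open>Y\<close> disjoint, since they are told apart by an entry that is
  \<open>\<zero>\<close> in one and \<open>\<one>\<close> in the other.\<close>

lemma End_ring_one_neq_zero:
  assumes "carrier M \<noteq> {\<zero>\<^bsub>M\<^esub>}"
  shows "\<one>\<^bsub>End_ring R M\<^esub> \<noteq> \<zero>\<^bsub>End_ring R M\<^esub>"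
proof
  assume "\<one>\<^bsub>End_ring R M\<^esub> = \<zero>\<^bsub>End_ring R M\<^esub>"
  then have "x = \<zero>\<^bsub>M\<^esub>" if "x \<in> carrier M" for x
    using End_ring_apply(3,4)[OF that] by simp
  with assms show False
    using M.zero_closed by blast
qed

end

section \<open>Square matrices over a ring record and their additive group\<close>

context
  fixes n :: nat and S :: "('e, 'c) ring_scheme"
begin

lemma mat_ring_entry_closed:
  "A \<in> carrier (mat_ring n S) \<Longrightarrow> i < n \<Longrightarrow> j < n \<Longrightarrow> A $$ (i, j) \<in> carrier S"
  by (simp add: mat_ring_def)

lemma mat_ring_dim:
  "A \<in> carrier (mat_ring n S) \<Longrightarrow> dim_row A = n"
  "A \<in> carrier (mat_ring n S) \<Longrightarrow> dim_col A = n"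
  by (auto simp: mat_ring_def)

lemma mat_ring_index:
  assumes "i < n" "j < n"
  shows "(A \<oplus>\<^bsub>mat_ring n S\<^esub> B) $$ (i, j) = A $$ (i, j) \<oplus>\<^bsub>S\<^esub> B $$ (i, j)"
    and "\<zero>\<^bsub>mat_ring n S\<^esub> $$ (i, j) = \<zero>\<^bsub>S\<^esub>"
  using assms by (simp_all add: mat_ring_def)

lemma mat_ring_eqI:
  assumes "A \<in> carrier (mat_ring n S)" "B \<in> carrier (mat_ring n S)"
    and "\<And>i j. i < n \<Longrightarrow> j < n \<Longrightarrow> A $$ (i, j) = B $$ (i, j)"
  shows "A = B"
  using assms by (intro eq_matI) (simp_all add: mat_ring_dim)

lemma mat_in_mat_ring:
  assumes "\<And>i j. i < n \<Longrightarrow> j < n \<Longrightarrow> f (i, j) \<in> carrier S"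
  shows "mat n n f \<in> carrier (mat_ring n S)"
  using assms by (simp add: mat_ring_def)

text \<open>The group laws hold entrywise. The result gives uniqueness of negatives, by which
  \<open>mat2_minus\<close> computes differences.\<close>

lemma abelian_group_mat_ring:
  assumes "abelian_group S"
  shows "abelian_group (mat_ring n S)"
proof -
  interpret S: abelian_group S by fact
  have add_closed: "A \<oplus>\<^bsub>mat_ring n S\<^esub> B \<in> carrier (mat_ring n S)"
    if "A \<in> carrier (mat_ring n S)" "B \<in> carrier (mat_ring n S)" for A B
    using that by (simp add: mat_ring_def)
  have zero_closed: "\<zero>\<^bsub>mat_ring n S\<^esub> \<in> carrier (mat_ring n S)"
    by (simp add: mat_ring_def)
  show ?thesis
  proof (rule abelian_groupI)
    fix A assume A: "A \<in> carrier (mat_ring n S)"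
    let ?B = "mat n n (\<lambda>ij. \<ominus>\<^bsub>S\<^esub> (A $$ ij))"
    have B: "?B \<in> carrier (mat_ring n S)"
      using A by (intro mat_in_mat_ring) (simp add: mat_ring_entry_closed)
    have "?B \<oplus>\<^bsub>mat_ring n S\<^esub> A = \<zero>\<^bsub>mat_ring n S\<^esub>"
      using A B by (intro mat_ring_eqI add_closed zero_closed)
        (simp_all add: mat_ring_index mat_ring_entry_closed S.l_neg)
    with B show "\<exists>B \<in> carrier (mat_ring n S). B \<oplus>\<^bsub>mat_ring n S\<^esub> A = \<zero>\<^bsub>mat_ring n S\<^esub>"
      by blast
  qed (simp add: add_closed zero_closed | rule mat_ring_eqI; simp add: add_closed zero_closed
      mat_ring_index mat_ring_entry_closed S.a_ac)+
qed

end

section \<open>2 x 2 matrices given by their four entries\<close>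

definition mat2 :: "'e \<Rightarrow> 'e \<Rightarrow> 'e \<Rightarrow> 'e \<Rightarrow> 'e mat" where
  "mat2 a b c d = mat 2 2 (\<lambda>(i, j). if i = 0 then if j = 0 then a else b else if j = 0 then c else d)"

lemma dim_mat2 [simp]: "dim_row (mat2 a b c d) = 2" "dim_col (mat2 a b c d) = 2"
  by (simp_all add: mat2_def)

text \<open>The second index is written \<open>Suc 0\<close>, the form to which the simplifier
  brings \<open>1\<close>.\<close>

lemma index_mat2 [simp]:
  "mat2 a b c d $$ (0, 0) = a" "mat2 a b c d $$ (0, Suc 0) = b"
  "mat2 a b c d $$ (Suc 0, 0) = c" "mat2 a b c d $$ (Suc 0, Suc 0) = d"
  by (simp_all add: mat2_def)

lemma mat2_eq_iff: "mat2 a b c d = mat2 a' b' c' d' \<longleftrightarrow> a = a' \<and> b = b' \<and> c = c' \<and> d = d'"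
proof
  assume eq: "mat2 a b c d = mat2 a' b' c' d'"
  have "mat2 a b c d $$ ij = mat2 a' b' c' d' $$ ij" for ij
    by (simp only: eq)
  from this[of "(0, 0)"] this[of "(0, Suc 0)"] this[of "(Suc 0, 0)"] this[of "(Suc 0, Suc 0)"]
  show "a = a' \<and> b = b' \<and> c = c' \<and> d = d'"
    by simp
qed simp

lemma mat2_eqI:
  assumes "dim_row A = 2" "dim_col A = 2"
    "A $$ (0, 0) = a" "A $$ (0, Suc 0) = b" "A $$ (Suc 0, 0) = c" "A $$ (Suc 0, Suc 0) = d"
  shows "A = mat2 a b c d"
proof (rule eq_matI)
  fix i j assume "i < dim_row (mat2 a b c d)" "j < dim_col (mat2 a b c d)"
  then have "i = 0 \<or> i = Suc 0" "j = 0 \<or> j = Suc 0"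
    by (simp_all add: less_2_cases_iff)
  then show "A $$ (i, j) = mat2 a b c d $$ (i, j)"
    using assms by (elim disjE) simp_all
qed (simp_all add: assms)

lemma mat2_in_mat_ring:
  "mat2 a b c d \<in> carrier (mat_ring 2 S) \<longleftrightarrow>
     a \<in> carrier S \<and> b \<in> carrier S \<and> c \<in> carrier S \<and> d \<in> carrier S"
proof -
  have all_less_2: "(\<forall>i < 2. P i) \<longleftrightarrow> P 0 \<and> P (Suc 0)" for P :: "nat \<Rightarrow> bool"
    by (auto simp: less_2_cases_iff)
  have "mat2 a b c d \<in> carrier_mat 2 2"
    by (rule carrier_matI) simp_all
  then have "mat2 a b c d \<in> carrier (mat_ring 2 S)
      \<longleftrightarrow> (\<forall>i < 2. \<forall>j < 2. mat2 a b c d $$ (i, j) \<in> carrier S)"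
    by (simp only: mat_ring_def partial_object.select_convs mem_Collect_eq simp_thms)
  then show ?thesis
    by (simp only: all_less_2 index_mat2 conj_assoc)
qed

lemma one_mat_ring_2: "\<one>\<^bsub>mat_ring 2 S\<^esub> = mat2 \<one>\<^bsub>S\<^esub> \<zero>\<^bsub>S\<^esub> \<zero>\<^bsub>S\<^esub> \<one>\<^bsub>S\<^esub>"
  by (rule mat2_eqI) (simp_all add: mat_ring_def)

lemma zero_mat_ring_2: "\<zero>\<^bsub>mat_ring 2 S\<^esub> = mat2 \<zero>\<^bsub>S\<^esub> \<zero>\<^bsub>S\<^esub> \<zero>\<^bsub>S\<^esub> \<zero>\<^bsub>S\<^esub>"
  by (rule mat2_eqI) (simp_all add: mat_ring_def)

lemma mat2_add:
  "mat2 a b c d \<oplus>\<^bsub>mat_ring 2 S\<^esub> mat2 a' b' c' d'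
     = mat2 (a \<oplus>\<^bsub>S\<^esub> a') (b \<oplus>\<^bsub>S\<^esub> b') (c \<oplus>\<^bsub>S\<^esub> c') (d \<oplus>\<^bsub>S\<^esub> d')"
  by (rule mat2_eqI) (simp_all add: mat_ring_def)

section \<open>Arithmetic and units of 2 x 2 matrices over a noncommutative ring\<close>

context ring
begin

lemma finsum_lessThan_2:
  assumes "f 0 \<in> carrier R" "f (Suc 0) \<in> carrier R"
  shows "(\<Oplus>k\<in>{..<2::nat}. f k) = f 0 \<oplus> f (Suc 0)"
proof -
  have "{..<2::nat} = {0, Suc 0}" by auto
  then show ?thesis using assms by simp
qed

lemma mat2_mult:
  assumes "a \<in> carrier R" "b \<in> carrier R" "c \<in> carrier R" "d \<in> carrier R"
    "a' \<in> carrier R" "b' \<in> carrier R" "c' \<in> carrier R" "d' \<in> carrier R"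
  shows "mat2 a b c d \<otimes>\<^bsub>mat_ring 2 R\<^esub> mat2 a' b' c' d'
     = mat2 (a \<otimes> a' \<oplus> b \<otimes> c') (a \<otimes> b' \<oplus> b \<otimes> d') (c \<otimes> a' \<oplus> d \<otimes> c') (c \<otimes> b' \<oplus> d \<otimes> d')"
  using assms
  by (intro mat2_eqI) (simp_all add: mat_ring_def finsum_lessThan_2)

text \<open>Negation in a ring record is given by a description operator, so the entrywise negative
  must be identified through uniqueness of additive inverses.\<close>

lemma mat2_minus:
  assumes "a \<in> carrier R" "b \<in> carrier R" "c \<in> carrier R" "d \<in> carrier R"
    "a' \<in> carrier R" "b' \<in> carrier R" "c' \<in> carrier R" "d' \<in> carrier R"
  shows "mat2 a b c d \<ominus>\<^bsub>mat_ring 2 R\<^esub> mat2 a' b' c' d'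
     = mat2 (a \<ominus> a') (b \<ominus> b') (c \<ominus> c') (d \<ominus> d')"
proof -
  interpret Mat: abelian_group "mat_ring 2 R"
    by (rule abelian_group_mat_ring) (rule abelian_group_axioms)
  have "\<ominus>\<^bsub>mat_ring 2 R\<^esub> mat2 a' b' c' d' = mat2 (\<ominus> a') (\<ominus> b') (\<ominus> c') (\<ominus> d')"
    using assms by (intro Mat.minus_equality)
      (auto simp: mat2_in_mat_ring mat2_add zero_mat_ring_2 l_neg)
  then show ?thesis
    by (simp add: a_minus_def mat2_add)
qed

lemma mat2_UnitsI:
  assumes "mat2 a b c d \<in> carrier (mat_ring 2 R)" "mat2 a' b' c' d' \<in> carrier (mat_ring 2 R)"
    and "mat2 a b c d \<otimes>\<^bsub>mat_ring 2 R\<^esub> mat2 a' b' c' d' = \<one>\<^bsub>mat_ring 2 R\<^esub>"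
    and "mat2 a' b' c' d' \<otimes>\<^bsub>mat_ring 2 R\<^esub> mat2 a b c d = \<one>\<^bsub>mat_ring 2 R\<^esub>"
  shows "mat2 a b c d \<in> Units (mat_ring 2 R)"
  using assms unfolding Units_def by blast

lemma lower_triangular_mat2_Units:
  assumes u: "u \<in> Units R" and v: "v \<in> Units R" and w: "w \<in> carrier R"
  shows "mat2 u \<zero> w v \<in> Units (mat_ring 2 R)"
proof (rule mat2_UnitsI)
  \<comment> \<open>The lower left entry \<open>x\<close> solves
    \<open>w \<otimes> inv u \<oplus> v \<otimes> x = \<zero>\<close>; the order of its factors
    matters.\<close>
  let ?N = "mat2 (inv u) \<zero> (\<ominus> (inv v \<otimes> w \<otimes> inv u)) (inv v)"
  note closed = u v w Units_closed[OF u] Units_closed[OF v]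
  show "mat2 u \<zero> w v \<in> carrier (mat_ring 2 R)" "?N \<in> carrier (mat_ring 2 R)"
    using closed by (auto simp: mat2_in_mat_ring)
  have "v \<otimes> (inv v \<otimes> w \<otimes> inv u) = w \<otimes> inv u"
    using closed by (simp add: m_assoc[symmetric])
  then show "mat2 u \<zero> w v \<otimes>\<^bsub>mat_ring 2 R\<^esub> ?N = \<one>\<^bsub>mat_ring 2 R\<^esub>"
    using closed by (simp add: mat2_mult one_mat_ring_2 mat2_eq_iff r_minus r_neg)
  have "inv v \<otimes> w \<otimes> inv u \<otimes> u = inv v \<otimes> w"
    using closed by (simp add: m_assoc)
  then show "?N \<otimes>\<^bsub>mat_ring 2 R\<^esub> mat2 u \<zero> w v = \<one>\<^bsub>mat_ring 2 R\<^esub>"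
    using closed by (simp add: mat2_mult one_mat_ring_2 mat2_eq_iff l_minus l_neg)
qed

text \<open>For pairwise commuting entries the adjugate \<open>?N\<close> multiplies the matrix,
  from either side, to the determinant times the identity.\<close>

lemma mat2_det_one_Units:
  assumes closed: "p \<in> carrier R" "r \<in> carrier R" "q \<in> carrier R" "s \<in> carrier R"
    and comm: "p \<otimes> r = r \<otimes> p" "p \<otimes> q = q \<otimes> p" "p \<otimes> s = s \<otimes> p"
      "r \<otimes> q = q \<otimes> r" "r \<otimes> s = s \<otimes> r" "q \<otimes> s = s \<otimes> q"
    and det: "p \<otimes> s \<ominus> r \<otimes> q = \<one>"
  shows "mat2 p r q s \<in> Units (mat_ring 2 R)"
proof (rule mat2_UnitsI)
  let ?N = "mat2 s (\<ominus> r) (\<ominus> q) p"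
  show "mat2 p r q s \<in> carrier (mat_ring 2 R)" "?N \<in> carrier (mat_ring 2 R)"
    using closed by (auto simp: mat2_in_mat_ring)
  \<comment> \<open>Rewriting with \<open>comm\<close> orders the products as
    \<open>s \<otimes> p\<close> and \<open>q \<otimes> r\<close>; the diagonal entries of the
    products show the determinant with its summands in either order, hence also
    \<open>det''\<close>.\<close>
  have det': "s \<otimes> p \<oplus> \<ominus> (q \<otimes> r) = \<one>"
    using det by (simp add: a_minus_def comm)
  then have det'': "\<ominus> (q \<otimes> r) \<oplus> s \<otimes> p = \<one>"
    using closed by (simp add: a_comm)
  show "mat2 p r q s \<otimes>\<^bsub>mat_ring 2 R\<^esub> ?N = \<one>\<^bsub>mat_ring 2 R\<^esub>"
    using closed by (simp add: mat2_mult one_mat_ring_2 mat2_eq_iff comm r_minus l_neg r_neg det' det'')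
  show "?N \<otimes>\<^bsub>mat_ring 2 R\<^esub> mat2 p r q s = \<one>\<^bsub>mat_ring 2 R\<^esub>"
    using closed by (simp add: mat2_mult one_mat_ring_2 mat2_eq_iff comm l_minus l_neg r_neg det' det'')
qed

section \<open>The two families of matrices and their differences\<close>

lemma Units_a_inv_closed: "u \<in> Units R \<Longrightarrow> \<ominus> u \<in> Units R"
  using Units_m_closed[OF Units_minus_one_closed, of u] by (simp add: l_minus Units_closed)

text \<open>True selects \<open>Y a\<close> and false selects \<open>X a\<close>. With a Boolean tag
  the doubled clique is an image of \<open>UNIV \<times> C\<close>, which has cardinality
  \<open>ctwo *c |C|\<close> by definition.\<close>

definition clique_mat :: "bool \<Rightarrow> 'a \<Rightarrow> 'a mat" where
  "clique_mat t a = (if t then mat2 a \<one> (\<ominus> (a \<otimes> a) \<ominus> \<one>) (\<ominus> a) else mat2 a \<zero> (\<ominus> (a \<otimes> a)) a)"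

lemma clique_mat_closed: "a \<in> carrier R \<Longrightarrow> clique_mat t a \<in> carrier (mat_ring 2 R)"
  by (simp add: clique_mat_def mat2_in_mat_ring)

text \<open>The upper right entry, \<open>\<one>\<close> or \<open>\<zero>\<close>, determines the
  tag, and the upper left entry is \<open>a\<close>.\<close>

lemma clique_mat_eq_iff:
  assumes "\<one> \<noteq> \<zero>"
  shows "clique_mat t a = clique_mat t' a' \<longleftrightarrow> t = t' \<and> a = a'"
  using assms by (auto simp: clique_mat_def mat2_eq_iff)

lemma clique_mat_minus_Units_same:
  assumes ab: "a \<in> carrier R" "b \<in> carrier R" and unit: "a \<ominus> b \<in> Units R"
  shows "clique_mat t a \<ominus>\<^bsub>mat_ring 2 R\<^esub> clique_mat t b \<in> Units (mat_ring 2 R)"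
proof -
  \<comment> \<open>This is the lower right entry for the tag true. The next fact makes the upper
    right entry, \<open>\<one> \<ominus> \<one>\<close> or \<open>\<zero> \<ominus> \<zero>\<close>,
    vanish.\<close>
  have "\<ominus> a \<ominus> (\<ominus> b) = \<ominus> (a \<ominus> b)"
    using ab by (simp add: a_minus_def minus_add)
  moreover have "x \<ominus> x = \<zero>" if "x \<in> carrier R" for x
    using that by (simp add: a_minus_def r_neg)
  ultimately show ?thesis
    using ab unit Units_a_inv_closed[OF unit]
    by (simp add: clique_mat_def mat2_minus lower_triangular_mat2_Units)
qed

text \<open>By commutation the diagonal contributes \<open>a^2 - b^2\<close> or its negative to the
  determinant. The lower left entries are chosen so that the other product cancels this and leaves
  \<open>\<one>\<close>.\<close>

lemma clique_mat_minus_Units_distinct: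
  assumes ab: "a \<in> carrier R" "b \<in> carrier R" and comm: "a \<otimes> b = b \<otimes> a" and "t \<noteq> t'"
  shows "clique_mat t a \<ominus>\<^bsub>mat_ring 2 R\<^esub> clique_mat t' b \<in> Units (mat_ring 2 R)"
proof -
  \<comment> \<open>Together with \<open>comm[symmetric]\<close> this moves every \<open>a\<close>
    in front of every \<open>b\<close> in right-nested products, giving monomials a normal
    form.\<close>
  have lcomm: "b \<otimes> (a \<otimes> x) = a \<otimes> (b \<otimes> x)" if "x \<in> carrier R" for x
    using ab that by (metis comm m_assoc)
  \<comment> \<open>The expanded determinant is \<open>\<one>\<close> plus the monomials
    \<open>a \<otimes> a\<close>, \<open>a \<otimes> b\<close> and \<open>b \<otimes> b\<close>,
    each with both signs; these six summands must cancel.\<close>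
  have cancel: "x \<oplus> (y \<oplus> (z \<oplus> (\<ominus> x \<oplus> (\<ominus> y \<oplus> \<ominus> z)))) = \<zero>"
    if "x \<in> carrier R" "y \<in> carrier R" "z \<in> carrier R" for x y z
    using that r_neg[of "x \<oplus> (y \<oplus> z)"] by (simp add: minus_add a_assoc)
  note expand = a_minus_def l_distr r_distr l_minus r_minus minus_add m_assoc comm[symmetric] lcomm
    a_ac cancel
  from \<open>t \<noteq> t'\<close> consider "t" "\<not> t'" | "\<not> t" "t'"
    by blast
  then show ?thesis
  proof cases
    case 1
    \<comment> \<open>The entries keep the unsimplified form that \<open>mat2_minus\<close> yields.
      They are polynomials in the commuting \<open>a\<close> and \<open>b\<close>, so they
      commute.\<close>
    have "mat2 (a \<ominus> b) (\<one> \<ominus> \<zero>) (\<ominus> (a \<otimes> a) \<ominus> \<one> \<ominus> (\<ominus> (b \<otimes> b))) (\<ominus> a \<ominus> b) \<in> Units (mat_ring 2 R)"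
      using ab by (intro mat2_det_one_Units) (simp_all add: expand)
    then show ?thesis
      using ab 1 by (simp add: clique_mat_def mat2_minus)
  next
    case 2
    have "mat2 (a \<ominus> b) (\<zero> \<ominus> \<one>) (\<ominus> (a \<otimes> a) \<ominus> (\<ominus> (b \<otimes> b) \<ominus> \<one>)) (a \<ominus> (\<ominus> b)) \<in> Units (mat_ring 2 R)"
      using ab by (intro mat2_det_one_Units) (simp_all add: expand)
    then show ?thesis
      using ab 2 by (simp add: clique_mat_def mat2_minus)
  qed
qed

end

lemma exceptional_clique_mat_ring_2:
  assumes "ring S" and one: "\<one>\<^bsub>S\<^esub> \<noteq> \<zero>\<^bsub>S\<^esub>" and C: "comm_exceptional_clique S C"
  shows "\<exists>D. exceptional_clique (mat_ring 2 S) D \<and> |D| =o ctwo *c |C|"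
proof -
  interpret S: ring S by fact
  let ?f = "\<lambda>(t, a). S.clique_mat t a"
  let ?D = "?f ` (UNIV \<times> C)"
  have closed: "C \<subseteq> carrier S"
    and unit: "\<And>a b. a \<in> C \<Longrightarrow> b \<in> C \<Longrightarrow> a \<noteq> b \<Longrightarrow> a \<ominus>\<^bsub>S\<^esub> b \<in> Units S"
    and comm: "\<And>a b. a \<in> C \<Longrightarrow> b \<in> C \<Longrightarrow> a \<otimes>\<^bsub>S\<^esub> b = b \<otimes>\<^bsub>S\<^esub> a"
    using C by (auto simp: comm_exceptional_clique_def exceptional_clique_def)
  have "exceptional_clique (mat_ring 2 S) ?D"
    unfolding exceptional_clique_def
  proof (intro conjI ballI impI)
    show "?D \<subseteq> carrier (mat_ring 2 S)"
      using closed by (auto simp: S.clique_mat_closed)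
  next
    fix A B assume "A \<in> ?D" "B \<in> ?D" and "A \<noteq> B"
    then obtain t a t' b where A: "A = S.clique_mat t a" and B: "B = S.clique_mat t' b"
      and ab: "a \<in> C" "b \<in> C"
      by auto
    show "A \<ominus>\<^bsub>mat_ring 2 S\<^esub> B \<in> Units (mat_ring 2 S)"
    proof (cases "t = t'")
      case True
      with \<open>A \<noteq> B\<close> A B have "a \<noteq> b" by blast
      with ab have "a \<ominus>\<^bsub>S\<^esub> b \<in> Units S" by (rule unit)
      with ab closed show ?thesis
        unfolding A B True by (intro S.clique_mat_minus_Units_same) auto
    next
      case False
      \<comment> \<open>Here \<open>a = b\<close> is possible: for different tags the unit comes
        from commutation alone, so \<open>X a\<close> and \<open>Y a\<close> also differ by a
        unit.\<close>
      with ab closed comm[OF ab] show ?thesis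
        unfolding A B by (intro S.clique_mat_minus_Units_distinct) auto
    qed
  qed
  moreover have "inj_on ?f (UNIV \<times> C)"
    by (rule inj_onI) (simp add: S.clique_mat_eq_iff[OF one] split_beta prod_eq_iff)
  then have "bij_betw ?f (UNIV \<times> C) ?D"
    by (rule inj_on_imp_bij_betw)
  \<comment> \<open>Counting by a bijection covers finite and infinite \<open>C\<close>
    alike.\<close>
  then have "|(UNIV :: bool set) \<times> C| =o |?D|"
    by (rule card_of_ordIsoI)
  then have "|?D| =o ctwo *c |C|"
    unfolding ctwo_def cprod_def Field_card_of by (rule ordIso_symmetric)
  ultimately show ?thesis by blast
qed

section \<open>Doubling and suprema of cardinals\<close>

lemma finite_card_of_ordLeq_iff:
  assumes "finite A" "finite B"
  shows "|A| \<le>o |B| \<longleftrightarrow> card A \<le> card B"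
  unfolding card_of_ordLeq[symmetric] using assms by (rule inj_on_iff_card_le)

text \<open>This carries a bound on each doubled clique over to the doubled supremum. The bound
  \<open>r\<close> has its own type because it will be a cardinal of matrices, while the family
  consists of sets of endomorphisms.\<close>

lemma ctwo_cprod_card_Sup_le:
  fixes r :: "'b rel"
  assumes "\<C> \<noteq> {}" and r: "Card_order r" and ub: "\<And>C. C \<in> \<C> \<Longrightarrow> ctwo *c |C| \<le>o r"
  shows "ctwo *c card_Sup \<C> \<le>o r"
proof (cases "finite (Field (card_Sup \<C>))")
  case True
  let ?\<kappa> = "card_Sup \<C>"
  have Sup_iso: "|Field ?\<kappa>| =o ?\<kappa>"
    by (rule card_of_Field_ordIso[OF Card_order_card_Sup])
  have le: "|C| \<le>o |Field ?\<kappa>|" if "C \<in> \<C>" for C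
    using card_Sup_upper[OF that] ordIso_symmetric[OF Sup_iso] by (rule ordLeq_ordIso_trans)
  have fin: "finite C" if "C \<in> \<C>" for C
    using card_of_ordLeq_finite[OF le[OF that] True] .
  have "card C \<le> card (Field ?\<kappa>)" if "C \<in> \<C>" for C
    using le[OF that] finite_card_of_ordLeq_iff[OF fin[OF that] True] by simp
  then have "card ` \<C> \<subseteq> {..card (Field ?\<kappa>)}"
    by blast
  then have "finite (card ` \<C>)"
    by (rule finite_subset) simp
  \<comment> \<open>The sizes form a bounded set of naturals, non-empty since \<open>\<C>\<close>
    is, so some \<open>C\<close> has the largest size and dominates the supremum.\<close>
  then have "Max (card ` \<C>) \<in> card ` \<C>" and ge: "\<And>C'. C' \<in> \<C> \<Longrightarrow> card C' \<le> Max (card ` \<C>)"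
    using \<open>\<C> \<noteq> {}\<close> by simp_all
  then obtain C where C: "C \<in> \<C>" and max: "Max (card ` \<C>) = card C"
    by (elim imageE)
  have "|C'| \<le>o |C|" if "C' \<in> \<C>" for C'
    using ge[OF that] finite_card_of_ordLeq_iff[OF fin[OF that] fin[OF C]] by (simp add: max)
  then have "?\<kappa> \<le>o |C|"
    by (intro card_Sup_least card_of_Card_order)
  then have "ctwo *c ?\<kappa> \<le>o ctwo *c |C|"
    by (rule cprod_mono2)
  then show ?thesis
    using ub[OF C] by (rule ordLeq_transitive)
next
  case False
  let ?\<kappa> = "card_Sup \<C>"
  have inf: "Cinfinite ?\<kappa>"
    using False Card_order_card_Sup by (simp add: cinfinite_def)
  have absorb: "ctwo *c ?\<kappa> =o ?\<kappa>"
    by (rule cprod_infinite2'[OF ctwo_Cnotzero inf ctwo_ordLeq_Cinfinite[OF inf]])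
  \<comment> \<open>As \<open>ctwo\<close> is non-zero, \<open>|C|\<close> is at most its double.
    Hence \<open>r\<close> bounds the supremum, which equals its own double by
    \<open>absorb\<close>.\<close>
  have "|C| \<le>o r" if "C \<in> \<C>" for C
    by (rule ordLeq_transitive[OF ordLeq_cprod2[OF ctwo_Cnotzero card_of_Card_order] ub[OF that]])
  then have "?\<kappa> \<le>o r"
    by (rule card_Sup_least[OF r])
  with absorb show ?thesis
    by (rule ordIso_ordLeq_trans)
qed

theorem theorem5p6:
  fixes R :: "('r, 'c) ring_scheme" and M :: "('r, 'a, 'd) module_scheme"
  assumes "left_module R M"
    and "carrier M \<noteq> {\<zero>\<^bsub>M\<^esub>}"
  shows "(\<forall>C. comm_exceptional_clique (End_ring R M) C \<longrightarrow>
            (\<exists>D. exceptional_clique (mat_ring 2 (End_ring R M)) D \<and> |D| =o ctwo *c |C| )) \<and>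
         ctwo *c omega_com (End_ring R M) \<le>o omega (mat_ring 2 (End_ring R M))"
proof
  interpret left_module R M by fact
  let ?E = "End_ring R M"
  have doubling: "\<exists>D. exceptional_clique (mat_ring 2 ?E) D \<and> |D| =o ctwo *c |C|"
    if "comm_exceptional_clique ?E C" for C
    using ring_End_ring End_ring_one_neq_zero[OF assms(2)] that
    by (rule exceptional_clique_mat_ring_2)
  then show "\<forall>C. comm_exceptional_clique ?E C \<longrightarrow>
      (\<exists>D. exceptional_clique (mat_ring 2 ?E) D \<and> |D| =o ctwo *c |C| )"
    by blast
  \<comment> \<open>The empty clique makes the family non-empty, as the maximum in the finite case
    requires.\<close>
  have "comm_exceptional_clique ?E {}"
    by (simp add: comm_exceptional_clique_def exceptional_clique_def)
  then have nonempty: "{C. comm_exceptional_clique ?E C} \<noteq> {}"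
    by blast
  have le: "ctwo *c |C| \<le>o omega (mat_ring 2 ?E)" if C: "C \<in> {C. comm_exceptional_clique ?E C}" for C
  proof -
    obtain D where D: "exceptional_clique (mat_ring 2 ?E) D" "|D| =o ctwo *c |C|"
      using doubling[of C] C by blast
    have "|D| \<le>o omega (mat_ring 2 ?E)"
      unfolding omega_def using D(1) by (intro card_Sup_upper) simp
    with ordIso_symmetric[OF D(2)] show ?thesis
      by (rule ordIso_ordLeq_trans)
  qed
  have "Card_order (omega (mat_ring 2 ?E))"
    unfolding omega_def by (rule Card_order_card_Sup)
  from ctwo_cprod_card_Sup_le[OF nonempty this le]
  show "ctwo *c omega_com ?E \<le>o omega (mat_ring 2 ?E)"
    unfolding omega_com_def .
qed

end
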